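(* Let $0<\beta\le 1$. Then for every $\lambda>0$ the fractional Poisson measure $\pi_{\lambda,\beta}$ is a mixture of Poisson measures with respect to the probability measure $\nu_\beta$ on $[0,\infty)$, i.e. $$\pi_{\lambda,\beta}=\int_0^\infty \pi_{\lambda\tau}\,\mathrm{d}\nu_\beta(\tau).$$
   Context: For $\beta\in(0,1]$ the Mittag-Leffler function is the entire function $E_\beta(z)=\sum_{n=0}^\infty \frac{z^n}{\Gamma(\beta n+1)}$, $z\in\mathbb{C}$, and $E_\beta^{(k)}$ denotes its $k$-th derivative. With $\mathbb{N}_0=\{0,1,2,\dots\}$, for $\lambda>0$ the fractional Poisson measure $\pi_{\lambda,\beta}$ is the measure on $\mathbb{N}_0$ (regarded also as a measure on $\mathbb{R}$) with $\pi_{\lambda,\beta}(\{k\})=\frac{\lambda^k}{k!}E_\beta^{(k)}(-\lambda)$, $k\in\mathbb{N}_0$. For $\mu>0$ the Poisson measure $\pi_\mu$ is given by $\pi_\mu(\{k\})=\frac{\mu^k}{k!}e^{-\mu}$, $k\in\mathbb{N}_0$ (and $\pi_0$ is the Dirac measure at $0$). The measure $\nu_\beta$ is the probability measure on $[0,\infty)$ determined by its Laplace transform $\int_0^\infty e^{-z\tau}\,\mathrm{d}\nu_\beta(\tau)=E_\beta(-z)$ for all $z\in\mathbb{C}$ (a known fact guarantees its existence). The integral of measures means $\left(\int_0^\infty \pi_{\lambda\tau}\,\mathrm{d}\nu_\beta(\tau)\right)(B)=\int_0^\infty\pi_{\lambda\tau}(B)\,\mathrm{d}\nu_\beta(\tau)$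 for every $B\subset\mathbb{N}_0$. *)

theory Defs
  imports "HOL-Probability.Probability"
begin

definition mittag_leffler :: "real \<Rightarrow> complex \<Rightarrow> complex" where
  "mittag_leffler \<beta> z = (\<Sum>n. z ^ n / of_real (Gamma (\<beta> * real n + 1)))"

definition fractional_poisson_weight :: "real \<Rightarrow> real \<Rightarrow> nat \<Rightarrow> complex" where
  "fractional_poisson_weight \<beta> l k =
     of_real l ^ k / fact k * (deriv ^^ k) (mittag_leffler \<beta>) (- of_real l)"

text \<open>
  The measure is characterised by its point masses, as an equation between complex numbers.
  That these weights are real and nonnegative is thus not built in by truncation: without it
  no such measure would exist. Uniqueness is shown below.
\<close>

definition is_fractional_poisson :: "real \<Rightarrow> real \<Rightarrow> nat measure \<Rightarrow> bool" where
  "is_fractional_poisson \<beta> l M \<longleftrightarrow>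
     sets M = UNIV \<and>
     (\<forall>k. emeasure M {k} \<noteq> \<infinity> \<and>
          complex_of_real (measure M {k}) = fractional_poisson_weight \<beta> l k)"

definition fractional_poisson :: "real \<Rightarrow> real \<Rightarrow> nat measure" where
  "fractional_poisson \<beta> l = (THE M. is_fractional_poisson \<beta> l M)"

lemma is_fractional_poisson_unique:
  assumes "is_fractional_poisson \<beta> l M" "is_fractional_poisson \<beta> l N"
  shows "M = N"
proof (rule measure_eqI_countable[of _ UNIV])
  show "sets M = Pow UNIV" "sets N = Pow UNIV"
    using assms by (auto simp: is_fractional_poisson_def)
  fix k :: nat
  have "measure M {k} = measure N {k}"
    using assms unfolding is_fractional_poisson_def by (metis of_real_eq_iff)
  moreover have "emeasure M {k} = ennreal (measure M {k})" "emeasure N {k} = ennreal (measure N {k})"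
    using assms by (auto simp: is_fractional_poisson_def intro!: emeasure_eq_ennreal_measure)
  ultimately show "emeasure M {k} = emeasure N {k}" by simp
qed auto

corollary fractional_poisson_eqI:
  assumes "is_fractional_poisson \<beta> l M"
  shows "fractional_poisson \<beta> l = M"
  unfolding fractional_poisson_def
  using assms is_fractional_poisson_unique by (intro the_equality) auto

text \<open>
  \<open>poisson_pmf\<close> is specified for positive rates only. The value for negative \<open>\<mu>\<close> is
  irrelevant.
\<close>

definition poisson_measure :: "real \<Rightarrow> nat measure" where
  "poisson_measure \<mu> =
     (if \<mu> > 0 then measure_pmf (poisson_pmf \<mu>) else return (count_space UNIV) 0)"

lemma emeasure_poisson_measure_singleton:
  assumes "\<mu> \<ge> 0"
  shows "emeasure (poisson_measure \<mu>) {k} = ennreal (\<mu> ^ k / fact k * exp (- \<mu>))"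
proof (cases "\<mu> > 0")
  case True
  then show ?thesis by (simp add: poisson_measure_def emeasure_pmf_single)
next
  case False
  with assms have "\<mu> = 0" by simp
  then show ?thesis by (cases k) (auto simp: poisson_measure_def)
qed

text \<open>
  The measure on \<open>[0, \<infinity>)\<close> with Laplace transform \<open>z \<mapsto> E\<^sub>\<beta>(-z)\<close>. The use of
  \<open>has_bochner_integral\<close> includes integrability of the integrand for every complex \<open>z\<close>.
\<close>

definition mittag_leffler_measure :: "real \<Rightarrow> real measure \<Rightarrow> bool" where
  "mittag_leffler_measure \<beta> \<nu> \<longleftrightarrow>
     prob_space \<nu> \<and>
     sets \<nu> = sets (restrict_space borel {0..}) \<and>
     (\<forall>z::complex. has_bochner_integral \<nu> (\<lambda>\<tau>. exp (- z * of_real \<tau>)) (mittag_leffler \<beta> (- z)))"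

text \<open>
  The mixture is the Giry bind; the next lemma gives its value on each set.
\<close>

definition poisson_mixture :: "real measure \<Rightarrow> real \<Rightarrow> nat measure" where
  "poisson_mixture \<nu> l = \<nu> \<bind> (\<lambda>\<tau>. poisson_measure (l * \<tau>))"

lemma measurable_poisson_measure:
  "poisson_measure \<in> restrict_space borel {0..} \<rightarrow>\<^sub>M subprob_algebra (count_space UNIV)"
proof (rule measurable_subprob_algebra)
  show "subprob_space (poisson_measure a)" for a
    by (auto simp: poisson_measure_def intro!: prob_space_imp_subprob_space prob_space_measure_pmf
        prob_space_return)
  show "sets (poisson_measure a) = sets (count_space UNIV)" for a
    by (simp add: poisson_measure_def)
  fix A :: "nat set"
  have "(\<lambda>a. emeasure (poisson_measure a) A) \<in> borel_measurable (restrict_space borel {0..}) \<longleftrightarrow>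
        (\<lambda>a. \<Sum>k. if k \<in> A then ennreal (a ^ k / fact k * exp (- a)) else 0)
          \<in> borel_measurable (restrict_space borel {0..})"
  proof (rule measurable_cong)
    fix a :: real assume "a \<in> space (restrict_space borel {0..})"
    then have a: "a \<ge> 0" by (simp add: space_restrict_space)
    have "emeasure (poisson_measure a) A = (\<integral>\<^sup>+k. emeasure (poisson_measure a) {k} \<partial>count_space A)"
      by (rule emeasure_countable_singleton) (auto simp: poisson_measure_def)
    also have "\<dots> = (\<integral>\<^sup>+k. (if k \<in> A then ennreal (a ^ k / fact k * exp (- a)) else 0) \<partial>count_space UNIV)"
      using a by (subst nn_integral_count_space_indicator)
        (auto simp: emeasure_poisson_measure_singleton intro!: nn_integral_cong split: split_indicator)
    also have "\<dots> = (\<Sum>k. if k \<in> A then ennreal (a ^ k / fact k * exp (- a)) else 0)"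
      by (rule nn_integral_count_space_nat)
    finally show "emeasure (poisson_measure a) A = \<dots>" .
  qed
  also have "\<dots>"
    by (rule measurable_restrict_space1) measurable
  finally show "(\<lambda>a. emeasure (poisson_measure a) A) \<in> borel_measurable (restrict_space borel {0..})" .
qed

lemma
  assumes "sets \<nu> = sets (restrict_space borel {0..})" "l > 0"
  shows sets_poisson_mixture: "sets (poisson_mixture \<nu> l) = UNIV"
    and emeasure_poisson_mixture:
      "emeasure (poisson_mixture \<nu> l) B = (\<integral>\<^sup>+\<tau>. emeasure (poisson_measure (l * \<tau>)) B \<partial>\<nu>)"
proof -
  have "(\<lambda>\<tau>. l * \<tau>) \<in> restrict_space borel {0..} \<rightarrow>\<^sub>M restrict_space borel {0..}"
    using assms(2) by (intro measurable_restrict_space3) auto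
  from measurable_compose[OF this measurable_poisson_measure]
  have m: "(\<lambda>\<tau>. poisson_measure (l * \<tau>)) \<in> \<nu> \<rightarrow>\<^sub>M subprob_algebra (count_space UNIV)"
    by (simp add: measurable_cong_sets[OF assms(1) refl])
  have ne: "space \<nu> \<noteq> {}"
    using sets_eq_imp_space_eq[OF assms(1)] by (simp add: space_restrict_space)
  show "sets (poisson_mixture \<nu> l) = UNIV"
    unfolding poisson_mixture_def by (subst sets_bind[OF sets_kernel[OF m] ne]) auto
  show "emeasure (poisson_mixture \<nu> l) B = (\<integral>\<^sup>+\<tau>. emeasure (poisson_measure (l * \<tau>)) B \<partial>\<nu>)"
    unfolding poisson_mixture_def by (rule emeasure_bind[OF ne m]) simp
qed

end

theory Submission
  imports Defs
begin

text \<open>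
  All exponential moments of \<open>\<nu>\<close> are finite, so the Laplace transform can be differentiated under
  the integral sign arbitrarily often. Hence \<open>E\<^sub>\<beta>\<close> has \<open>k\<close>-th derivative
  \<open>\<integral> \<tau>\<^sup>k exp (-\<lambda>\<tau>) d\<nu>(\<tau>)\<close> at \<open>-\<lambda>\<close>, and multiplying by \<open>\<lambda>\<^sup>k / k!\<close> gives the integral of the
  Poisson weights of rate \<open>\<lambda>\<tau>\<close>.
\<close>

text \<open>A single term of the exponential series with nonnegative terms is at most its
  sum.\<close>

lemma abs_power_le_fact_exp:
  fixes x :: real
  shows "\<bar>x\<bar> ^ n \<le> fact n * exp \<bar>x\<bar>"
proof -
  have "(\<Sum>k\<in>{n}. \<bar>x\<bar> ^ k / fact k) \<le> (\<Sum>k. \<bar>x\<bar> ^ k / fact k)"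
    using summable_exp[of "\<bar>x\<bar>"] by (intro sum_le_suminf) (auto simp: field_simps)
  then have "\<bar>x\<bar> ^ n / fact n \<le> exp \<bar>x\<bar>"
    by (simp add: exp_def divide_inverse mult.commute)
  then show ?thesis
    by (simp add: field_simps)
qed

lemma Re_times_real_le:
  fixes x :: real
  shows "Re w * x \<le> norm w * \<bar>x\<bar>"
proof -
  have "\<bar>Re w * x\<bar> \<le> norm w * \<bar>x\<bar>"
    unfolding abs_mult by (intro mult_right_mono abs_Re_le_cmod) simp
  then show ?thesis
    by linarith
qed

context
  fixes M :: "'a measure" and f :: "'a \<Rightarrow> real"
  assumes f_measurable [measurable]: "f \<in> borel_measurable M"
    and exp_integrable: "\<And>x::real. integrable M (\<lambda>t. exp (x * f t))"
begin

text \<open>The power is absorbed by raising the rate from \<open>c\<close> to \<open>c + 1\<close>.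
  The absolute value in the exponent is then removed by adding the exponentials of both signs, one
  of which is the required one. These functions serve as integrable majorants below.\<close>

lemma integrable_abs_power_exp_abs:
  "integrable M (\<lambda>t. \<bar>f t\<bar> ^ k * exp (c * \<bar>f t\<bar>))"
proof (rule Bochner_Integration.integrable_bound)
  show "integrable M (\<lambda>t. fact k * (exp ((c + 1) * f t) + exp (- (c + 1) * f t)))"
    by (intro integrable_mult_right Bochner_Integration.integrable_add exp_integrable)
  have "\<bar>x\<bar> ^ k * exp (c * \<bar>x\<bar>) \<le> fact k * (exp ((c + 1) * x) + exp (- (c + 1) * x))" for x :: real
  proof -
    have "\<bar>x\<bar> ^ k * exp (c * \<bar>x\<bar>) \<le> (fact k * exp \<bar>x\<bar>) * exp (c * \<bar>x\<bar>)"
      by (intro mult_right_mono abs_power_le_fact_exp) auto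
    also have "\<dots> = fact k * exp ((c + 1) * \<bar>x\<bar>)"
      by (simp add: exp_add ring_distribs)
    also have "exp ((c + 1) * \<bar>x\<bar>) \<le> exp ((c + 1) * x) + exp (- (c + 1) * x)"
      by (cases "x \<ge> 0") (auto simp: algebra_simps)
    finally show ?thesis
      by simp
  qed
  then show "AE t in M. norm (\<bar>f t\<bar> ^ k * exp (c * \<bar>f t\<bar>))
      \<le> norm (fact k * (exp ((c + 1) * f t) + exp (- (c + 1) * f t)))"
    by (auto simp: abs_mult)
qed measurable

lemma integrable_power_exp:
  fixes w :: complex
  shows "integrable M (\<lambda>t. of_real (f t) ^ k * exp (w * of_real (f t)))"
proof (rule Bochner_Integration.integrable_bound[OF integrable_abs_power_exp_abs[of k "norm w"]])
  show "AE t in M. norm (of_real (f t) ^ k * exp (w * of_real (f t)))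
      \<le> norm (\<bar>f t\<bar> ^ k * exp (norm w * \<bar>f t\<bar>))"
    by (auto simp: norm_mult norm_power abs_mult intro!: mult_left_mono Re_times_real_le)
qed measurable

text \<open>The second-order Taylor remainder of the integrand is at most
  \<open>(norm h)\<^sup>2\<close> times an integrable function independent of \<open>h\<close>.
  Integrating and dividing by \<open>h\<close> leaves an explicit error of order
  \<open>norm h\<close> in the difference quotient.\<close>

lemma has_field_derivative_integral_power_exp:
  fixes w :: complex
  shows "((\<lambda>w. \<integral>t. of_real (f t) ^ k * exp (w * of_real (f t)) \<partial>M) has_field_derivative
          (\<integral>t. of_real (f t) ^ Suc k * exp (w * of_real (f t)) \<partial>M)) (at w)"
proof -
  define F :: "nat \<Rightarrow> complex \<Rightarrow> 'a \<Rightarrow> complex"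
    where "F k w t = of_real (f t) ^ k * exp (w * of_real (f t))" for k w t
  \<comment> \<open>The exponent \<open>k + 2\<close> combines the factor of degree \<open>k\<close>
    with the quadratic remainder. In the rate, \<open>norm w\<close> bounds
    \<open>exp (w * x)\<close>, and the extra 1 bounds the exponential in the Taylor remainder for
    \<open>norm h < 1\<close>.\<close>
  define b where "b t = \<bar>f t\<bar> ^ (k + 2) * exp ((norm w + 1) * \<bar>f t\<bar>)" for t
  have int_F: "integrable M (F k w)" for k w
    unfolding F_def by (rule integrable_power_exp)
  have int_b: "integrable M b"
    unfolding b_def by (rule integrable_abs_power_exp_abs)
  have pointwise: "norm (F k (w + h) t - F k w t - h * F (Suc k) w t) \<le> (norm h)\<^sup>2 * b t"
    if h: "norm h < 1" for h t
  proof -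
    define x where "x = f t"
    have "F k (w + h) t - F k w t - h * F (Suc k) w t
        = of_real x ^ k * exp (w * of_real x) * (exp (h * of_real x) - (1 + h * of_real x))"
      by (simp add: F_def x_def exp_add algebra_simps)
    also have "norm \<dots> = \<bar>x\<bar> ^ k * exp (Re w * x) * norm (exp (h * of_real x) - (1 + h * of_real x))"
      by (simp add: norm_mult norm_power)
    also have "\<dots> \<le> \<bar>x\<bar> ^ k * exp (norm w * \<bar>x\<bar>) * (exp \<bar>x\<bar> * (norm h * \<bar>x\<bar>)\<^sup>2)"
    proof (intro mult_mono mult_nonneg_nonneg)
      show "exp (Re w * x) \<le> exp (norm w * \<bar>x\<bar>)"
        by (simp add: Re_times_real_le)
      have "norm (exp (h * of_real x) - (\<Sum>i\<le>1. (h * of_real x) ^ i / fact i))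
          \<le> exp \<bar>Re (h * of_real x)\<bar> * norm (h * of_real x) ^ Suc 1 / fact 1"
        by (rule Taylor_exp)
      also have "\<bar>Re (h * of_real x)\<bar> \<le> \<bar>x\<bar>"
        using h abs_Re_le_cmod[of h] by (auto simp: abs_mult intro!: mult_left_le_one_le)
      finally show "norm (exp (h * of_real x) - (1 + h * of_real x)) \<le> exp \<bar>x\<bar> * (norm h * \<bar>x\<bar>)\<^sup>2"
        by (simp add: norm_mult power2_eq_square mult_right_mono)
    qed auto
    also have "\<dots> = (norm h)\<^sup>2 * b t"
      by (simp add: b_def x_def exp_add power_mult_distrib power_add power2_eq_square ring_distribs)
    finally show ?thesis .
  qed
  define I where "I k w = (\<integral>t. F k w t \<partial>M)" for k w
  have quotient: "norm ((I k (w + h) - I k w) / h - I (Suc k) w) \<le> norm h * (\<integral>t. b t \<partial>M)"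
    if h: "h \<noteq> 0" "norm h < 1" for h
  proof -
    \<comment> \<open>Multiplying by \<open>h\<close> turns the quotient into the integral of the
      pointwise remainder; one of the two factors \<open>norm h\<close> in its bound is cancelled at
      the end.\<close>
    have "((I k (w + h) - I k w) / h - I (Suc k) w) * h = I k (w + h) - I k w - h * I (Suc k) w"
      using h by (simp add: left_diff_distrib diff_divide_distrib)
    then have "norm ((I k (w + h) - I k w) / h - I (Suc k) w) * norm h
        = norm (I k (w + h) - I k w - h * I (Suc k) w)"
      by (simp flip: norm_mult)
    also have "I k (w + h) - I k w - h * I (Suc k) w
        = (\<integral>t. F k (w + h) t - F k w t - h * F (Suc k) w t \<partial>M)"
      by (simp add: I_def int_F)
    also have "norm \<dots> \<le> (\<integral>t. (norm h)\<^sup>2 * b t \<partial>M)"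
      by (intro order_trans[OF integral_norm_bound integral_mono] pointwise h) (auto simp: int_F int_b)
    also have "\<dots> = norm h * (\<integral>t. b t \<partial>M) * norm h"
      by (simp add: power2_eq_square)
    finally show ?thesis
      using h by (simp add: mult.commute)
  qed
  have "((\<lambda>h. (I k (w + h) - I k w) / h - I (Suc k) w) \<longlongrightarrow> 0) (at 0)"
  proof (rule Lim_null_comparison)
    show "\<forall>\<^sub>F h in at 0. norm ((I k (w + h) - I k w) / h - I (Suc k) w) \<le> norm h * (\<integral>t. b t \<partial>M)"
      using quotient by (auto simp: eventually_at dist_norm intro!: exI[of _ 1])
    show "((\<lambda>h::complex. norm h * (\<integral>t. b t \<partial>M)) \<longlongrightarrow> 0) (at 0)"
      by (auto intro!: tendsto_eq_intros)
  qed
  then have "(I k has_field_derivative I (Suc k) w) (at w)"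
    by (simp add: DERIV_def Lim_null[symmetric])
  then show ?thesis
    by (simp add: I_def[abs_def] F_def[abs_def])
qed

text \<open>Each differentiation brings down one more factor \<open>f t\<close>. Equality as
  functions, not just at one point, lets \<open>deriv\<close> be applied to the induction
  hypothesis.\<close>

lemma higher_deriv_integral_exp:
  "(deriv ^^ k) (\<lambda>w::complex. \<integral>t. exp (w * of_real (f t)) \<partial>M)
   = (\<lambda>w. \<integral>t. of_real (f t) ^ k * exp (w * of_real (f t)) \<partial>M)"
proof (induction k)
  case (Suc k)
  show ?case
    unfolding funpow.simps comp_apply Suc
    by (intro ext DERIV_imp_deriv has_field_derivative_integral_power_exp)
qed simp

end

theorem lemma2p4:
  fixes \<beta> l :: real and \<nu> :: "real measure"
  assumes "0 < \<beta>" and "\<beta> \<le> 1"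
    and "mittag_leffler_measure \<beta> \<nu>"
    and "l > 0"
  shows "fractional_poisson \<beta> l = poisson_mixture \<nu> l"
proof (rule fractional_poisson_eqI, unfold is_fractional_poisson_def, intro conjI allI)
  \<comment> \<open>Since point masses determine the measure, it suffices that those of the mixture
    are finite and equal the prescribed complex weights.\<close>
  have sets_nu: "sets \<nu> = sets (restrict_space borel {0..})"
    and laplace: "\<And>z::complex. has_bochner_integral \<nu> (\<lambda>t. exp (- z * of_real t)) (mittag_leffler \<beta> (- z))"
    using assms(3) by (auto simp: mittag_leffler_measure_def)
  show "sets (poisson_mixture \<nu> l) = UNIV"
    using sets_nu \<open>l > 0\<close> by (rule sets_poisson_mixture)
  have space_nu: "space \<nu> = {0..}"
    using sets_eq_imp_space_eq[OF sets_nu] by (simp add: space_restrict_space)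
  have meas [measurable]: "(\<lambda>t. t) \<in> borel_measurable \<nu>"
    unfolding measurable_cong_sets[OF sets_nu refl] by (rule measurable_restrict_space1) simp
  \<comment> \<open>The integrand is the norm of the Laplace integrand at \<open>z = -x\<close>;
    since all complex \<open>z\<close> are allowed, growing exponentials are covered too.\<close>
  have exp_int: "integrable \<nu> (\<lambda>t. exp (x * t))" for x :: real
  proof -
    have "integrable \<nu> (\<lambda>t. norm (exp (- of_real (- x) * complex_of_real t)))"
      using laplace by (intro integrable_norm) (rule integrable.intros)
    then show ?thesis by simp
  qed
  have E: "mittag_leffler \<beta> = (\<lambda>w. \<integral>t. exp (w * of_real t) \<partial>\<nu>)"
    using has_bochner_integral_integral_eq[OF laplace[of "- w" for w]] by (auto simp: fun_eq_iff)
  fix k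
  define p where "p t = (l * t) ^ k / fact k * exp (- (l * t))" for t
  \<comment> \<open>Separating \<open>l ^ k\<close> from \<open>t ^ k\<close> exposes the integrand
    of the \<open>k\<close>-th derivative at \<open>-l\<close>.\<close>
  have p_complex: "complex_of_real (p t)
      = of_real l ^ k / fact k * (of_real t ^ k * exp (- of_real l * of_real t))" for t
    by (simp add: p_def power_mult_distrib exp_of_real[symmetric])
  have int_pc: "integrable \<nu> (\<lambda>t. complex_of_real (p t))"
    unfolding p_complex by (intro integrable_mult_right integrable_power_exp meas exp_int)
  then have int_p: "integrable \<nu> p"
    by (simp add: complex_of_real_integrable_eq)
  \<comment> \<open>For odd \<open>k\<close> this would fail at negative \<open>t\<close>.
    Nonnegativity ensures that passing to \<open>ennreal\<close> and back truncates nothing.\<close>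
  have p_nonneg: "p t \<ge> 0" if "t \<in> space \<nu>" for t
    using that \<open>l > 0\<close> by (simp add: p_def space_nu)
  have "emeasure (poisson_mixture \<nu> l) {k} = (\<integral>\<^sup>+t. emeasure (poisson_measure (l * t)) {k} \<partial>\<nu>)"
    using sets_nu \<open>l > 0\<close> by (rule emeasure_poisson_mixture)
  also have "\<dots> = (\<integral>\<^sup>+t. ennreal (p t) \<partial>\<nu>)"
    using \<open>l > 0\<close> by (intro nn_integral_cong) (simp add: emeasure_poisson_measure_singleton p_def space_nu)
  also have "\<dots> = ennreal (\<integral>t. p t \<partial>\<nu>)"
    using int_p p_nonneg by (intro nn_integral_eq_integral) auto
  finally have mix: "emeasure (poisson_mixture \<nu> l) {k} = ennreal (\<integral>t. p t \<partial>\<nu>)" .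
  then show "emeasure (poisson_mixture \<nu> l) {k} \<noteq> \<infinity>"
    by simp
  have "measure (poisson_mixture \<nu> l) {k} = (\<integral>t. p t \<partial>\<nu>)"
    using mix p_nonneg by (simp add: measure_def Bochner_Integration.integral_nonneg)
  then have "complex_of_real (measure (poisson_mixture \<nu> l) {k}) = (\<integral>t. complex_of_real (p t) \<partial>\<nu>)"
    by simp
  also have "\<dots> = of_real l ^ k / fact k * (\<integral>t. of_real t ^ k * exp (- of_real l * of_real t) \<partial>\<nu>)"
    unfolding p_complex by (rule integral_mult_right_zero)
  also have "\<dots> = fractional_poisson_weight \<beta> l k"
    \<comment> \<open>\<open>E\<close> represents the Mittag-Leffler function on the whole complex
      plane, so its derivatives at \<open>-l\<close> are those of the integral.\<close>
    unfolding fractional_poisson_weight_def E higher_deriv_integral_exp[OF meas exp_int] ..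
  finally show "complex_of_real (measure (poisson_mixture \<nu> l) {k}) = fractional_poisson_weight \<beta> l k" .
qed

end
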